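(* (i) In a complete bipartite graph $K_{m,n}$ with partite sets $A$ and $B$, $|A|=m$ and $|B|=n$, $$\mathrm{str}(v)=\begin{cases}\dfrac{n(n-1)}{2}, & \text{if } v\in A,\\[2mm] \dfrac{m(m-1)}{2}, & \text{if } v\in B.\end{cases}$$ Consequently, $N_{\mathrm{str}}(K_{m,n})=\dfrac{mn}{2}(m+n-2)$. (ii) For every vertex $v$ in a cycle $C_n$ on $n$ vertices, $$\mathrm{str}(v)=\begin{cases}\dfrac{(n-1)(n-3)}{8}, & \text{if } n \text{ is odd},\\[2mm] \dfrac{n(n-2)}{8}, & \text{if } n \text{ is even}.\end{cases}$$ Thus $$N_{\mathrm{str}}(C_n)=\begin{cases}\dfrac{n(n-1)(n-3)}{8}, & \text{if } n \text{ is odd},\\[2mm] \dfrac{n^2(n-2)}{8}, & \text{if } n \text{ is even}.\end{cases}$$ (iii) Let $n\ge 2$ and $m\ge 2$, and let $Wd(n,m)$ be the windmill graph with shared universal vertex $v$. Then $\mathrm{str}(v)=m(m-1)(n-1)^2/2$ and the rest of the vertices have zero stress. Hence $N_{\mathrm{str}}(Wd(n,m))=m(m-1)(n-1)^2/2$.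
   Context: Graphs are finite, undirected and simple (in particular cycles $C_n$ have $n\ge 3$). A geodesic is a shortest path between two vertices (a path and its reverse are the same geodesic); it passes through a vertex $v$ if $v$ is an internal vertex of it. The stress $\mathrm{str}(v)$ of a vertex $v$ is the number of geodesics in the graph passing through $v$. The total stress of $G=(V,E)$ is $N_{\mathrm{str}}(G)=\sum_{v\in V}\mathrm{str}(v)$. The windmill graph $Wd(n,m)$, for $n\ge2$, $m\ge2$, is constructed by joining $m$ copies of the complete graph $K_n$ at a single shared universal vertex (so it has $m(n-1)+1$ vertices). *)

theory Defs
  imports Complex_Main "Graph_Theory.Graph_Theory"
begin

text \<open>A finite simple undirected graph is a symmetric digraph without loops and parallel arcs,
  i.e. an instance of the locale \<^locale>\<open>graph\<close>. A path is a \<^const>\<open>vpath\<close>: the nonempty list of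
  its pairwise distinct vertices, consecutive ones being adjacent.\<close>

definition shortest_vpath :: "('a, 'b) pre_digraph \<Rightarrow> 'a vwalk \<Rightarrow> bool" where
  "shortest_vpath G p \<longleftrightarrow> vpath p G \<and>
     (\<forall>q. vpath q G \<and> hd q = hd p \<and> last q = last p \<longrightarrow> vwalk_length p \<le> vwalk_length q)"

text \<open>A path and its reverse are the same geodesic, so a geodesic is the set consisting of the two
  vertex lists that traverse it (a singleton for paths of length 0).\<close>

definition geodesics :: "('a, 'b) pre_digraph \<Rightarrow> 'a vwalk set set" where
  "geodesics G = {{p, rev p} | p. shortest_vpath G p}"

definition internal_verts :: "'a vwalk \<Rightarrow> 'a set" where
  "internal_verts p = set (butlast (tl p))"

definition passes_through :: "'a vwalk set \<Rightarrow> 'a \<Rightarrow> bool" where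
  "passes_through g v \<longleftrightarrow> (\<exists>p\<in>g. v \<in> internal_verts p)"

definition stress :: "('a, 'b) pre_digraph \<Rightarrow> 'a \<Rightarrow> nat" where
  "stress G v = card {g \<in> geodesics G. passes_through g v}"

definition total_stress :: "('a, 'b) pre_digraph \<Rightarrow> nat" where
  "total_stress G = (\<Sum>v\<in>verts G. stress G v)"

text \<open>The library's \<^const>\<open>complete_bipartite_digraph\<close> with its partite sets made explicit.\<close>

definition complete_bipartite_on :: "'a set \<Rightarrow> 'a set \<Rightarrow> ('a, 'b) pre_digraph \<Rightarrow> bool" where
  "complete_bipartite_on A B G \<longleftrightarrow> graph G \<and> verts G = A \<union> B \<and> A \<inter> B = {} \<and>
     arcs_ends G = A \<times> B \<union> B \<times> A"

lemma complete_bipartite_digraph_iff: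
  "complete_bipartite_digraph m n G \<longleftrightarrow>
     (\<exists>A B. complete_bipartite_on A B G \<and> card A = m \<and> card B = n)"
  unfolding complete_bipartite_digraph_def complete_bipartite_on_def by blast

definition cycle_graph :: "nat \<Rightarrow> ('a, 'b) pre_digraph \<Rightarrow> bool" where
  "cycle_graph n G \<longleftrightarrow> graph G \<and> 3 \<le> n \<and>
     (\<exists>c. bij_betw c {..<n} (verts G) \<and>
       arcs_ends G = {(c i, c (Suc i mod n)) | i. i < n} \<union> {(c (Suc i mod n), c i) | i. i < n})"

text \<open>\<open>H 0, \<dots>, H (m - 1)\<close> are the copies of the complete graph on \<open>n\<close> vertices; any two
  of them have exactly the vertex \<open>v\<close> in common.\<close>

definition windmill_graph :: "nat \<Rightarrow> nat \<Rightarrow> 'a \<Rightarrow> ('a, 'b) pre_digraph \<Rightarrow> bool" where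
  "windmill_graph n m v G \<longleftrightarrow> graph G \<and>
     (\<exists>H :: nat \<Rightarrow> ('a, 'b) pre_digraph.
        (\<forall>i<m. complete_digraph n (H i) \<and> v \<in> verts (H i)) \<and>
        (\<forall>i<m. \<forall>j<m. i \<noteq> j \<longrightarrow> verts (H i) \<inter> verts (H j) = {v}) \<and>
        verts G = (\<Union>i<m. verts (H i)) \<and>
        arcs_ends G = (\<Union>i<m. arcs_ends (H i)))"

end

theory Submission
  imports Defs
begin

text \<open>
  A path with an internal vertex is not its own reverse, so twice the stress of \<open>v\<close> is the number of
  directed shortest paths that have \<open>v\<close> inside (\<open>double_stress\<close>). It remains to know the
  shortest paths of each family.

  In complete bipartite graphs and in windmills two vertices joined by a path are at distance at
  most \<open>2\<close>. The directed geodesics through \<open>v\<close> are then the paths \<open>x, v, y\<close> whose ends are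
  different, non-adjacent neighbours of \<open>v\<close> (\<open>double_stress_short_geodesics\<close>). For \<open>v\<close> in a partite
  set these are the ordered pairs of different vertices of the other partite set. For the centre of
  a windmill they are the ordered pairs of vertices from different blades, of which there are
  \<open>(m (n - 1))\<^sup>2 - m (n - 1)\<^sup>2\<close>; any other vertex of a windmill has only pairwise adjacent neighbours.

  In a cycle a path never turns back, hence is an arc, and an arc with \<open>d\<close> edges is shortest iff it
  is not longer than the complementary arc, that is iff \<open>2 d \<le> n\<close> (\<open>shortest_arc_walk_iff\<close>). For
  every such \<open>d \<ge> 1\<close> and each of the two directions there are \<open>d - 1\<close> arcs with \<open>d\<close> edges that have
  a given vertex inside, one for each position of that vertex on the arc. With \<open>k\<close> the integer part
  of \<open>n / 2\<close>, the stress is therefore \<open>0 + 1 + \<dots> + (k - 1) = k (k - 1) / 2\<close>; the two parities of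
  \<open>n\<close> give the two formulas.

  Each total stress is the sum of these values over the vertices.
\<close>

section \<open>Geodesics through a vertex as directed shortest paths\<close>

lemma in_internal_verts_iff:
  "v \<in> internal_verts p \<longleftrightarrow> (\<exists>j. 0 < j \<and> Suc j < length p \<and> p ! j = v)"
proof
  assume "v \<in> internal_verts p"
  then obtain k where "k < length (butlast (tl p))" "butlast (tl p) ! k = v"
    unfolding internal_verts_def in_set_conv_nth by blast
  then show "\<exists>j. 0 < j \<and> Suc j < length p \<and> p ! j = v"
    by (intro exI[of _ "Suc k"]) (simp add: nth_butlast nth_tl)
next
  assume "\<exists>j. 0 < j \<and> Suc j < length p \<and> p ! j = v"
  then obtain k where "Suc (Suc k) < length p" "p ! Suc k = v"
    by (metis gr0_implies_Suc)
  then show "v \<in> internal_verts p"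
    unfolding internal_verts_def in_set_conv_nth
    by (intro exI[of _ k]) (simp add: nth_butlast nth_tl)
qed

lemma internal_verts_rev: "internal_verts (rev p) = internal_verts p"
  by (metis internal_verts_def butlast_rev butlast_tl rev_rev_ident set_rev)

lemma length_vwalk_to_vpath_le: "length (vwalk_to_vpath p) \<le> length p"
proof (induct p rule: vwalk_to_vpath_induct3)
  case (in_set x xs)
  then show ?case
    using length_dropWhile_le[of "\<lambda>y. y \<noteq> x" xs] by simp
qed auto

text \<open>A walk can be shortened to a path with the same ends, so shortest paths are also shortest
  among walks; competitors therefore need not be checked for repeated vertices.\<close>

lemma shortest_vpath_le_vwalk:
  assumes "shortest_vpath G p" "vwalk q G" "hd q = hd p" "last q = last p"
  shows "length p \<le> length q"
proof -
  let ?r = "vwalk_to_vpath q"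
  have "vpath ?r G" "hd ?r = hd p" "last ?r = last p"
    using assms by (simp_all add: vwalk_to_vpath_vpath vwalk_to_vpath_hd vwalk_to_vpath_last)
  then have "length p - 1 \<le> length ?r - 1"
    using assms(1) by (auto simp: shortest_vpath_def)
  moreover have "?r \<noteq> []" "p \<noteq> []"
    using \<open>vpath ?r G\<close> assms(1) by (auto simp: vpath_def shortest_vpath_def)
  ultimately have "length p \<le> length ?r"
    by (cases ?r; cases p) auto
  then show ?thesis
    using length_vwalk_to_vpath_le[of q] by linarith
qed

lemma shortest_vpath_ends_in_verts:
  assumes "shortest_vpath G p"
  shows "hd p \<in> verts G" "last p \<in> verts G"
  using assms by (auto simp: shortest_vpath_def vpath_def vwalk_def)

lemma (in graph) vpath_rev: "vpath p G \<Longrightarrow> vpath (rev p) G"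
  by (auto simp: vpath_def vwalk_def set_vwalk_arcs_rev intro: arcs_ends_symmetric)

lemma (in graph) shortest_vpath_rev:
  assumes "shortest_vpath G p"
  shows "shortest_vpath G (rev p)"
  unfolding shortest_vpath_def
proof (intro conjI allI impI)
  show "vpath (rev p) G"
    using assms by (simp add: shortest_vpath_def vpath_rev)
next
  fix q assume q: "vpath q G \<and> hd q = hd (rev p) \<and> last q = last (rev p)"
  have "vpath (rev q) G" "hd (rev q) = hd p" "last (rev q) = last p"
    using q assms by (auto simp: vpath_rev hd_rev last_rev)
  then have "vwalk_length p \<le> vwalk_length (rev q)"
    using assms unfolding shortest_vpath_def by blast
  then show "vwalk_length (rev p) \<le> vwalk_length q"
    by simp
qed

lemma (in graph) finite_shortest_vpaths: "finite {p. shortest_vpath G p \<and> Q p}"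
proof (rule finite_subset)
  show "{p. shortest_vpath G p \<and> Q p} \<subseteq> {p. set p \<subseteq> verts G \<and> distinct p}"
    by (auto simp: shortest_vpath_def vpath_def vwalk_def)
qed (rule finite_subset_distinct[OF finite_verts])

text \<open>A path with an internal vertex has two different ends, hence differs from its reverse, and a
  geodesic through a vertex is a class of exactly two directed shortest paths. Counting directed
  paths removes the quotient from all later computations.\<close>

lemma (in graph) double_stress:
  "2 * stress G v = card {p. shortest_vpath G p \<and> v \<in> internal_verts p}"
proof -
  define P where "P = {p. shortest_vpath G p \<and> v \<in> internal_verts p}"
  let ?C = "(\<lambda>p. {p, rev p}) ` P"
  have rev_P: "rev p \<in> P" if "p \<in> P" for p
    using that by (simp add: P_def shortest_vpath_rev internal_verts_rev)
  have geodesics: "{g \<in> geodesics G. passes_through g v} = ?C"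
    by (auto simp: geodesics_def passes_through_def P_def internal_verts_rev)
  have union: "\<Union>?C = P"
    using rev_P by auto
  have "2 * card ?C = card (\<Union>?C)"
  proof (rule card_partition)
    have "finite P"
      unfolding P_def by (rule finite_shortest_vpaths)
    then show "finite ?C" "finite (\<Union>?C)"
      by simp_all
  next
    fix g assume "g \<in> ?C"
    then obtain p where p: "p \<in> P" "g = {p, rev p}"
      by auto
    then have "distinct p" "Suc 0 < length p"
      by (auto simp: P_def shortest_vpath_def vpath_def in_internal_verts_iff)
    then have "hd p \<noteq> last p"
      by (cases p) auto
    then have "p \<noteq> rev p"
      by (metis hd_rev)
    then show "card g = 2"
      using p by simp
  next
    fix g h assume "g \<in> ?C" "h \<in> ?C" "g \<noteq> h"
    then show "g \<inter> h = {}"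
      by auto
  qed
  then have "2 * card ?C = card P"
    by (simp only: union)
  then show ?thesis
    unfolding stress_def geodesics P_def[symmetric] .
qed

section \<open>Graphs in which all geodesics have at most two edges\<close>

text \<open>Here a geodesic through \<open>v\<close> is a path \<open>x, v, y\<close>, and such a path is shortest precisely when
  its ends are different and not adjacent.\<close>

lemma (in graph) double_stress_short_geodesics:
  assumes short: "\<And>p. shortest_vpath G p \<Longrightarrow> length p \<le> 3"
  shows "2 * stress G v = card {(x, y). (x, v) \<in> arcs_ends G \<and> (v, y) \<in> arcs_ends G \<and>
           x \<noteq> y \<and> (x, y) \<notin> arcs_ends G}" (is "_ = card ?R")
proof -
  let ?P = "{p. shortest_vpath G p \<and> v \<in> internal_verts p}"
  have "?P = (\<lambda>(x, y). [x, v, y]) ` ?R"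
  proof (intro equalityI subsetI)
    fix p assume "p \<in> ?P"
    then have p: "shortest_vpath G p" "v \<in> internal_verts p"
      by auto
    then obtain j where j: "0 < j" "Suc j < length p" "p ! j = v"
      by (auto simp: in_internal_verts_iff)
    with short[OF p(1)] have "length p = 3" "j = 1"
      by auto
    then obtain x y where xy: "p = [x, v, y]"
      using j(3) by (auto simp: numeral_3_eq_3 length_Suc_conv)
    have arcs: "(x, v) \<in> arcs_ends G" "(v, y) \<in> arcs_ends G" "x \<noteq> y"
      "x \<in> verts G" "y \<in> verts G"
      using p(1) by (auto simp: xy shortest_vpath_def vpath_def vwalk_def)
    have "(x, y) \<notin> arcs_ends G"
    proof
      assume "(x, y) \<in> arcs_ends G"
      then have "vwalk [x, y] G"
        using arcs by (auto simp: vwalk_def)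
      from shortest_vpath_le_vwalk[OF p(1) this] show False
        by (simp add: xy)
    qed
    then show "p \<in> (\<lambda>(x, y). [x, v, y]) ` ?R"
      using arcs xy by auto
  next
    fix p assume "p \<in> (\<lambda>(x, y). [x, v, y]) ` ?R"
    then obtain x y where xy: "p = [x, v, y]" "(x, v) \<in> arcs_ends G" "(v, y) \<in> arcs_ends G"
      "x \<noteq> y" "(x, y) \<notin> arcs_ends G"
      by auto
    have vpath: "vpath p G"
      using xy adj_in_verts adj_not_same by (auto simp: vpath_def vwalk_def)
    have "3 \<le> length q" if q: "vpath q G" "hd q = x" "last q = y" for q
    proof (rule ccontr)
      assume "\<not> 3 \<le> length q"
      then consider "length q = 0" | "length q = 1" | "length q = 2"
        by linarith
      then show False
        using q xy by cases (auto simp: vpath_def vwalk_def length_Suc_conv numeral_2_eq_2)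
    qed
    then have "shortest_vpath G p"
      using vpath xy(1) unfolding shortest_vpath_def by fastforce
    then show "p \<in> ?P"
      by (simp add: internal_verts_def xy(1))
  qed
  moreover have "inj_on (\<lambda>(x, y). [x, v, y]) ?R"
    by (auto simp: inj_on_def)
  ultimately show ?thesis
    by (simp add: double_stress card_image)
qed

section \<open>Complete bipartite graphs\<close>

lemma complete_bipartite_on_commute:
  "complete_bipartite_on A B G \<Longrightarrow> complete_bipartite_on B A G"
  by (auto simp: complete_bipartite_on_def)

text \<open>Vertices of different partite sets are adjacent, and the second vertex of a path with both
  ends in one partite set is a common neighbour of the ends.\<close>

lemma complete_bipartite_short_geodesics:
  assumes G: "complete_bipartite_on A B G" and p: "shortest_vpath G p"
  shows "length p \<le> 3"
proof (rule ccontr)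
  assume long: "\<not> length p \<le> 3"
  then have "Suc (Suc (Suc 0)) \<le> length p"
    by simp
  then obtain x y r where xy: "p = x # y # r" "r \<noteq> []"
    by (auto simp: Suc_le_length_iff)
  have xy_arc: "(x, y) \<in> arcs_ends G"
    using p by (auto simp: xy shortest_vpath_def vpath_def vwalk_def)
  have ends: "x \<in> verts G" "y \<in> verts G" "last p \<in> verts G"
    using p shortest_vpath_ends_in_verts[OF p] by (auto simp: xy shortest_vpath_def vpath_def vwalk_def)
  have arcs: "arcs_ends G = A \<times> B \<union> B \<times> A" "verts G = A \<union> B" "A \<inter> B = {}"
    using G by (auto simp: complete_bipartite_on_def)
  show False
  proof (cases "(x, last p) \<in> arcs_ends G")
    case True
    then have "vwalk [x, last p] G"
      using ends by (auto simp: vwalk_def)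
    from shortest_vpath_le_vwalk[OF p this] show False
      using long by (simp add: xy)
  next
    case False
    then have "(y, last p) \<in> arcs_ends G"
      using ends xy_arc arcs by blast
    then have "vwalk [x, y, last p] G"
      using ends xy_arc by (auto simp: vwalk_def)
    from shortest_vpath_le_vwalk[OF p this] show False
      using long by (simp add: xy)
  qed
qed

text \<open>The geodesics through a vertex of \<open>A\<close> correspond to the pairs of different vertices of \<open>B\<close>.\<close>

lemma stress_complete_bipartite:
  assumes G: "complete_bipartite_on A B G" and v: "v \<in> A"
  shows "real (stress G v) = real (card B) * (real (card B) - 1) / 2"
proof -
  interpret graph G
    using G by (simp add: complete_bipartite_on_def)
  have arcs: "arcs_ends G = A \<times> B \<union> B \<times> A" "A \<inter> B = {}" and fin: "finite B"
    using G finite_verts by (auto simp: complete_bipartite_on_def)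
  have "{(x, y). (x, v) \<in> arcs_ends G \<and> (v, y) \<in> arcs_ends G \<and> x \<noteq> y \<and> (x, y) \<notin> arcs_ends G}
      = B \<times> B - (\<lambda>x. (x, x)) ` B"
    using arcs v by auto
  moreover have "card (B \<times> B - (\<lambda>x. (x, x)) ` B) = card B * card B - card B"
    using fin by (subst card_Diff_subset) (auto simp: card_image inj_on_def)
  ultimately have "2 * stress G v = card B * card B - card B"
    using double_stress_short_geodesics[OF complete_bipartite_short_geodesics[OF G]] by simp
  then have "2 * real (stress G v) = real (card B * card B - card B)"
    by linarith
  then show ?thesis
    by (simp add: algebra_simps)
qed

lemma total_stress_complete_bipartite:
  assumes G: "complete_bipartite_on A B G"
  shows "real (total_stress G)
    = real (card A) * real (card B) / 2 * (real (card A) + real (card B) - 2)"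
proof -
  interpret graph G
    using G by (simp add: complete_bipartite_on_def)
  have V: "verts G = A \<union> B" "A \<inter> B = {}"
    using G by (auto simp: complete_bipartite_on_def)
  have "real (total_stress G) = (\<Sum>v\<in>A. real (stress G v)) + (\<Sum>v\<in>B. real (stress G v))"
    using V finite_verts by (simp add: total_stress_def sum.union_disjoint)
  also have "\<dots> = real (card A) * (real (card B) * (real (card B) - 1) / 2)
      + real (card B) * (real (card A) * (real (card A) - 1) / 2)"
    by (simp add: stress_complete_bipartite[OF G]
        stress_complete_bipartite[OF complete_bipartite_on_commute[OF G]])
  finally show ?thesis
    by (simp add: field_simps)
qed

section \<open>Cycles\<close>

text \<open>Unrolling a cycle to the integers: the vertices are labelled \<open>n\<close>-periodically by the integers,
  so that neighbours are the vertices with consecutive labels. Positions along a path can then be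
  added and subtracted without reducing modulo \<open>n\<close>.\<close>

locale cyclic_labelling = graph G for G :: "('a, 'b) pre_digraph" +
  fixes n :: nat and f :: "int \<Rightarrow> 'a"
  assumes n_ge_3: "3 \<le> n"
    and f_eq_iff: "f z = f w \<longleftrightarrow> int n dvd z - w"
    and range_f: "range f = verts G"
    and arc_iff: "(f z, x) \<in> arcs_ends G \<longleftrightarrow> x = f (z + 1) \<or> x = f (z - 1)"

lemma cycle_graph_obtains_labelling:
  fixes G :: "('a, 'b) pre_digraph"
  assumes "cycle_graph n G"
  obtains f where "cyclic_labelling G n f"
proof -
  from assms obtain c where n: "3 \<le> n" and graph: "graph G" and c: "bij_betw c {..<n} (verts G)"
    and arcs: "arcs_ends G
      = {(c i, c (Suc i mod n)) | i. i < n} \<union> {(c (Suc i mod n), c i) | i. i < n}"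
    unfolding cycle_graph_def by blast
  define f where "f z = c (nat (z mod int n))" for z
  have f_of_nat: "f (int i) = c (i mod n)" for i
    by (simp add: f_def flip: zmod_int)
  have f_eq: "f z = f w \<longleftrightarrow> int n dvd z - w" for z w
  proof -
    have "f z = f w \<longleftrightarrow> nat (z mod int n) = nat (w mod int n)"
      unfolding f_def using n c
      by (intro inj_on_eq_iff[of c "{..<n}"]) (auto simp: bij_betw_def nat_less_iff)
    also have "\<dots> \<longleftrightarrow> z mod int n = w mod int n"
      using n by (simp add: eq_nat_nat_iff)
    finally show ?thesis
      by (simp add: mod_eq_dvd_iff)
  qed
  have arcs_f: "(x, y) \<in> arcs_ends G \<longleftrightarrow>
      (\<exists>z. x = f z \<and> y = f (z + 1)) \<or> (\<exists>z. y = f z \<and> x = f (z + 1))" for x y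
  proof -
    have step: "(\<exists>i<n. x = c i \<and> y = c (Suc i mod n)) \<longleftrightarrow> (\<exists>z. x = f z \<and> y = f (z + 1))" for x y
    proof
      assume "\<exists>i<n. x = c i \<and> y = c (Suc i mod n)"
      then obtain i where "i < n" "x = c i" "y = c (Suc i mod n)"
        by blast
      then have "x = f (int i)" "y = f (int i + 1)"
        using f_of_nat[of i] f_of_nat[of "Suc i"] by (auto simp: add.commute)
      then show "\<exists>z. x = f z \<and> y = f (z + 1)"
        by blast
    next
      assume "\<exists>z. x = f z \<and> y = f (z + 1)"
      then obtain z where z: "x = f z" "y = f (z + 1)"
        by blast
      let ?i = "nat (z mod int n)"
      have i: "?i < n" "int ?i = z mod int n"
        using n by (auto simp: nat_less_iff)
      have "f (z + 1) = f (int (Suc ?i))"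
        using i(2) by (simp add: f_eq)
      then have "y = c (Suc ?i mod n)"
        using z f_of_nat[of "Suc ?i"] by simp
      moreover have "x = c ?i"
        using z by (simp add: f_def)
      ultimately show "\<exists>i<n. x = c i \<and> y = c (Suc i mod n)"
        using i(1) by blast
    qed
    have "(x, y) \<in> arcs_ends G \<longleftrightarrow>
        (\<exists>i<n. x = c i \<and> y = c (Suc i mod n)) \<or> (\<exists>i<n. y = c i \<and> x = c (Suc i mod n))"
      unfolding arcs by blast
    then show ?thesis
      by (simp only: step)
  qed
  have "cyclic_labelling G n f"
  proof (intro cyclic_labelling.intro cyclic_labelling_axioms.intro)
    show "range f = verts G"
    proof
      show "range f \<subseteq> verts G"
        using n c by (auto simp: f_def bij_betw_def nat_less_iff)
      show "verts G \<subseteq> range f"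
      proof
        fix x assume "x \<in> verts G"
        then obtain i where "i < n" "x = c i"
          using c by (auto simp: bij_betw_def)
        then show "x \<in> range f"
          by (metis f_of_nat mod_less rangeI)
      qed
    qed
  next
    fix z x
    show "(f z, x) \<in> arcs_ends G \<longleftrightarrow> x = f (z + 1) \<or> x = f (z - 1)"
    proof
      assume "(f z, x) \<in> arcs_ends G"
      then consider w where "f z = f w" "x = f (w + 1)" | w where "f z = f (w + 1)" "x = f w"
        unfolding arcs_f by blast
      then show "x = f (z + 1) \<or> x = f (z - 1)"
      proof cases
        case (1 w)
        then have "f (z + 1) = f (w + 1)"
          by (simp add: f_eq)
        with 1 show ?thesis
          by simp
      next
        case (2 w)
        then have "f (z - 1) = f w"
          by (simp add: f_eq algebra_simps)
        with 2 show ?thesis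
          by simp
      qed
    next
      assume "x = f (z + 1) \<or> x = f (z - 1)"
      moreover have "(f z, f (z + 1)) \<in> arcs_ends G"
        unfolding arcs_f by blast
      moreover have "(f (z - 1 + 1), f (z - 1)) \<in> arcs_ends G"
        unfolding arcs_f by blast
      ultimately show "(f z, x) \<in> arcs_ends G"
        by auto
    qed
  qed (use n graph f_eq in auto)
  then show thesis
    by (rule that)
qed

context cyclic_labelling
begin

text \<open>The direction \<open>s\<close> is meant to be \<open>1\<close> or \<open>-1\<close>; \<open>d\<close> counts edges, so there are \<open>d + 1\<close> vertices.\<close>

definition arc_walk :: "int \<Rightarrow> int \<Rightarrow> nat \<Rightarrow> 'a vwalk" where
  "arc_walk s i d = map (\<lambda>k. f (i + s * int k)) [0..<Suc d]"

lemma length_arc_walk [simp]: "length (arc_walk s i d) = Suc d"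
  by (simp add: arc_walk_def)

lemma arc_walk_nth: "k \<le> d \<Longrightarrow> arc_walk s i d ! k = f (i + s * int k)"
  by (simp add: arc_walk_def del: upt_Suc)

lemma arc_walk_not_Nil [simp]: "arc_walk s i d \<noteq> []"
  by (simp add: arc_walk_def)

lemma hd_arc_walk [simp]: "hd (arc_walk s i d) = f i"
  by (simp add: hd_conv_nth arc_walk_nth)

lemma last_arc_walk [simp]: "last (arc_walk s i d) = f (i + s * int d)"
  by (simp add: last_conv_nth arc_walk_nth)

lemma arc_walk_0: "arc_walk s i 0 = [f i]"
  by (simp add: arc_walk_def)

lemma arc_walk_Suc: "arc_walk s i (Suc d) = f i # arc_walk s (i + s) d"
  by (rule nth_equalityI) (auto simp: arc_walk_nth nth_Cons' algebra_simps)

lemma vwalk_arc_walk: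
  assumes "s \<in> {1, -1}"
  shows "vwalk (arc_walk s i d) G"
proof (induct d arbitrary: i)
  case 0
  then show ?case
    using range_f by (auto simp: arc_walk_0 vwalk_def)
next
  case (Suc d)
  have "(f i, f (i + s)) \<in> arcs_ends G"
    using assms by (auto simp: arc_iff)
  then show ?case
    using Suc[of "i + s"] by (simp add: arc_walk_Suc vwalk_wf_digraph_consI)
qed

lemma distinct_arc_walk_iff:
  assumes "s \<in> {1, -1}"
  shows "distinct (arc_walk s i d) \<longleftrightarrow> d < n"
proof
  assume "distinct (arc_walk s i d)"
  then have "d < n \<or> \<not> n \<le> d \<or> f (i + s * int n) \<noteq> f i"
    using n_ge_3 nth_eq_iff_index_eq[of "arc_walk s i d" n 0] by (auto simp: arc_walk_nth)
  then show "d < n"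
    by (auto simp: f_eq_iff)
next
  assume "d < n"
  have "j = k" if "j \<le> d" "k \<le> d" "f (i + s * int j) = f (i + s * int k)" for j k
  proof -
    have "int n dvd int j - int k"
      using that(3) assms by (auto simp: f_eq_iff dvd_diff_commute)
    then show "j = k"
      using that \<open>d < n\<close> dvd_imp_le_int[of "int j - int k" "int n"] by (cases "j = k") auto
  qed
  then show "distinct (arc_walk s i d)"
    by (auto simp: distinct_conv_nth arc_walk_nth less_Suc_eq_le)
qed

text \<open>Having entered \<open>f i\<close> in direction \<open>s\<close>, a path cannot turn back, as the only other neighbour of
  \<open>f i\<close> has just been visited.\<close>

lemma vpath_keeps_direction:
  assumes "s \<in> {1, -1}" "vwalk (f i # r) G" "distinct (f (i - s) # f i # r)"
  shows "f i # r = arc_walk s i (length r)"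
  using assms(2,3)
proof (induct r arbitrary: i)
  case Nil
  then show ?case
    by (simp add: arc_walk_0)
next
  case (Cons x r)
  have "(f i, x) \<in> arcs_ends G"
    using Cons.prems(1) by (simp add: vwalk_def)
  then have "x = f (i + s) \<or> x = f (i - s)"
    using assms(1) by (auto simp: arc_iff)
  then have x: "x = f (i + s)"
    using Cons.prems(2) by auto
  have "vwalk (f (i + s) # r) G"
    using Cons.prems(1) x by (auto elim: vwalk_consE)
  then have "x # r = arc_walk s (i + s) (length r)"
    using Cons.hyps[of "i + s"] Cons.prems(2) x by auto
  then show ?case
    by (simp add: arc_walk_Suc)
qed

lemma vpath_is_arc_walk:
  assumes "vpath p G" "hd p = f i"
  obtains s where "s \<in> {1, -1}" "p = arc_walk s i (length p - 1)"
proof -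
  obtain r where p: "p = f i # r"
    using assms by (cases p) (auto simp: vpath_def vwalk_def)
  show thesis
  proof (cases r)
    case Nil
    then show thesis
      using that[of 1] p by (simp add: arc_walk_0)
  next
    case (Cons x t)
    then have "(f i, x) \<in> arcs_ends G"
      using assms(1) p by (simp add: vpath_def vwalk_def)
    then have "\<exists>s\<in>{1, -1}. x = f (i + s)"
      by (simp add: arc_iff)
    then obtain s where s: "s \<in> {1, -1}" "x = f (i + s)"
      by blast
    have "vwalk (f (i + s) # t) G"
      using assms(1) p Cons s(2) by (auto simp: vpath_def elim: vwalk_consE)
    moreover have "distinct (f (i + s - s) # f (i + s) # t)"
      using assms(1) p Cons s(2) by (auto simp: vpath_def)
    ultimately have "f (i + s) # t = arc_walk s (i + s) (length t)"
      by (rule vpath_keeps_direction[OF s(1)])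
    then have "p = arc_walk s i (length p - 1)"
      using p Cons s(2) by (simp add: arc_walk_Suc)
    with s(1) show thesis
      by (rule that)
  qed
qed

text \<open>The only rival of an arc with \<open>d\<close> edges is the complementary arc, which has \<open>n - d\<close> edges. If
  \<open>2 * d = n\<close> both are shortest.\<close>

lemma shortest_arc_walk_iff:
  assumes s: "s \<in> {1, -1}"
  shows "shortest_vpath G (arc_walk s i d) \<longleftrightarrow> 2 * d \<le> n"
proof
  assume shortest: "shortest_vpath G (arc_walk s i d)"
  then have "d < n"
    using distinct_arc_walk_iff[OF s] by (auto simp: shortest_vpath_def vpath_def)
  have "f (i + - s * int (n - d)) = f (i + s * int d)"
    using \<open>d < n\<close> by (simp add: f_eq_iff algebra_simps)
  then have "length (arc_walk s i d) \<le> length (arc_walk (- s) i (n - d))"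
    using s by (intro shortest_vpath_le_vwalk[OF shortest] vwalk_arc_walk) auto
  then show "2 * d \<le> n"
    using \<open>d < n\<close> by simp
next
  assume d: "2 * d \<le> n"
  then have "d < n"
    using n_ge_3 by linarith
  have "vpath (arc_walk s i d) G"
    using \<open>d < n\<close> by (simp add: vpath_def vwalk_arc_walk[OF s] distinct_arc_walk_iff[OF s])
  moreover have "d \<le> length q - 1"
    if q: "vpath q G" "hd q = f i" "last q = f (i + s * int d)" for q
  proof -
    from vpath_is_arc_walk[OF q(1,2)] obtain t
      where t: "t \<in> {1, -1}" "q = arc_walk t i (length q - 1)" .
    define e where "e = length q - 1"
    have "f (i + t * int e) = f (i + s * int d)"
      using t(2) q(3) last_arc_walk unfolding e_def by metis
    then have "int n dvd t * int e - s * int d"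
      by (simp add: f_eq_iff)
    \<comment> \<open>The first case is \<open>s = t\<close>, the second \<open>s = - t\<close>; since \<open>d \<le> n - d\<close>, both force \<open>d \<le> e\<close>.\<close>
    then have "int n dvd int d - int e \<or> int n dvd int d + int e"
      using s t(1) by (auto simp: dvd_diff_commute dvd_minus_iff[of _ "int d + int e", symmetric]
          simp del: dvd_minus_iff)
    then show "d \<le> length q - 1"
      using d \<open>d < n\<close> zdvd_imp_le[of "int n" "int d - int e"] zdvd_imp_le[of "int n" "int d + int e"]
      unfolding e_def[symmetric] by linarith
  qed
  ultimately show "shortest_vpath G (arc_walk s i d)"
    by (simp add: shortest_vpath_def)
qed

text \<open>A directed shortest path through \<open>f a\<close> is determined by its direction, its number \<open>d\<close> of edges
  and the position \<open>j\<close> of \<open>f a\<close> on it.\<close>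

lemma bij_betw_shortest_vpaths_through:
  "bij_betw (\<lambda>(s, d, j). arc_walk s (a - s * int j) d)
     ({1, -1} \<times> (SIGMA d:{..n div 2}. {1..<d}))
     {p. shortest_vpath G p \<and> f a \<in> internal_verts p}"
  (is "bij_betw ?w ?I ?P")
proof (rule bij_betwI')
  fix x y assume "x \<in> ?I" "y \<in> ?I"
  then obtain s d j t e k where x: "x = (s, d, j)" "s \<in> {1, -1}" "2 * d \<le> n" "0 < j" "j < d"
    and y: "y = (t, e, k)" "t \<in> {1, -1}" "2 * e \<le> n" "0 < k" "k < e"
    by auto
  show "?w x = ?w y \<longleftrightarrow> x = y"
  proof
    assume "?w x = ?w y"
    then have w: "arc_walk s (a - s * int j) d = arc_walk t (a - t * int k) e"
      by (simp add: x y)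
    then have d: "d = e"
      by (metis length_arc_walk nat.inject)
    let ?p = "arc_walk s (a - s * int j) d"
    have "distinct ?p"
      using x by (subst distinct_arc_walk_iff) auto
    moreover have "?p ! j = f a"
      using x by (simp add: arc_walk_nth)
    moreover have "?p ! k = f a"
      unfolding w using y by (simp add: arc_walk_nth)
    ultimately have j: "j = k"
      using x y d nth_eq_iff_index_eq[of ?p j k] by simp
    have "?p ! Suc j = f (a + s)"
      using x by (simp add: arc_walk_nth algebra_simps)
    moreover have "?p ! Suc j = f (a + t)"
      unfolding w using y j by (simp add: arc_walk_nth algebra_simps)
    ultimately have "int n dvd t - s"
      by (simp add: f_eq_iff)
    \<comment> \<open>The two directions differ at \<open>f a\<close> because \<open>n\<close> exceeds \<open>2\<close>.\<close>
    then have "s = t"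
      using x(2) y(2) n_ge_3 zdvd_imp_le[of "int n" 2] by auto
    then show "x = y"
      using d j x y by simp
  qed simp
next
  fix x assume "x \<in> ?I"
  then obtain s d j where x: "x = (s, d, j)" "s \<in> {1, -1}" "2 * d \<le> n" "0 < j" "j < d"
    by auto
  then have "shortest_vpath G (?w x)"
    using shortest_arc_walk_iff by simp
  moreover have "f a \<in> internal_verts (?w x)"
    unfolding in_internal_verts_iff using x by (intro exI[of _ j]) (simp add: arc_walk_nth)
  ultimately show "?w x \<in> ?P"
    by simp
next
  fix p assume "p \<in> ?P"
  then have p: "shortest_vpath G p" "f a \<in> internal_verts p"
    by auto
  then obtain j where j: "0 < j" "Suc j < length p" "p ! j = f a"
    by (auto simp: in_internal_verts_iff)
  obtain i where i: "hd p = f i"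
    using shortest_vpath_ends_in_verts(1)[OF p(1)] range_f by auto
  define d where "d = length p - 1"
  obtain s where s: "s \<in> {1, -1}" "p = arc_walk s i d"
    using vpath_is_arc_walk[OF _ i] p(1) unfolding d_def shortest_vpath_def by blast
  have "2 * d \<le> n"
    using p(1) shortest_arc_walk_iff[OF s(1)] s(2) by simp
  moreover have "j < d"
    using j(2) d_def by simp
  moreover have "p = arc_walk s (a - s * int j) d"
  proof -
    have "f (i + s * int j) = f a"
      using j(3) \<open>j < d\<close> s(2) by (simp add: arc_walk_nth)
    then have "f (i + s * int k) = f (a - s * int j + s * int k)" for k
      by (simp add: f_eq_iff algebra_simps)
    then show ?thesis
      unfolding s(2) by (simp add: arc_walk_def)
  qed
  ultimately show "\<exists>x\<in>?I. p = ?w x"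
    using s(1) j(1) by (intro bexI[of _ "(s, d, j)"]) auto
qed

text \<open>The truncated \<open>d - 1\<close> is \<open>0\<close> for \<open>d = 0\<close>, as it should be: a single vertex has no internal
  vertex.\<close>

lemma stress_eq: "stress G (f a) = (\<Sum>d\<le>n div 2. d - 1)"
proof -
  have "2 * stress G (f a) = card ({1, -1 :: int} \<times> (SIGMA d:{..n div 2}. {1..<d}))"
    unfolding double_stress using bij_betw_same_card[OF bij_betw_shortest_vpaths_through] by simp
  also have "\<dots> = 2 * (\<Sum>d\<le>n div 2. d - 1)"
    by (simp add: card_cartesian_product)
  finally show ?thesis
    by simp
qed

lemma card_verts: "card (verts G) = n"
proof -
  have "bij_betw f {0..<int n} (verts G)"
  proof (rule bij_betw_imageI)
    show "inj_on f {0..<int n}"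
    proof (rule inj_onI)
      fix z w assume "z \<in> {0..<int n}" "w \<in> {0..<int n}" "f z = f w"
      then show "z = w"
        using mod_eq_dvd_iff[of z "int n" w] by (simp add: f_eq_iff)
    qed
    have "f z = f (z mod int n)" for z
      by (simp add: f_eq_iff minus_mod_eq_mult_div)
    moreover have "z mod int n \<in> {0..<int n}" for z
      using n_ge_3 by simp
    ultimately have "range f \<subseteq> f ` {0..<int n}"
      by blast
    then show "f ` {0..<int n} = verts G"
      using range_f by blast
  qed
  then show ?thesis
    using bij_betw_same_card by fastforce
qed

end

lemma sum_pred_atMost: "real (\<Sum>d\<le>k. d - 1) = real k * (real k - 1) / 2"
  by (induct k) (auto simp: field_simps)

lemma stress_cycle:
  assumes "cycle_graph n G" "v \<in> verts G"
  shows "real (stress G v) = (if odd n then (real n - 1) * (real n - 3) / 8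
           else real n * (real n - 2) / 8)"
proof -
  obtain f where "cyclic_labelling G n f"
    using assms(1) by (rule cycle_graph_obtains_labelling)
  then interpret cyclic_labelling G n f .
  obtain a where "v = f a"
    using assms(2) range_f by auto
  then have *: "real (stress G v) = real (n div 2) * (real (n div 2) - 1) / 2"
    by (simp only: stress_eq sum_pred_atMost)
  show ?thesis
  proof (cases "odd n")
    case True
    then obtain k where "n = 2 * k + 1"
      by (elim oddE)
    then show ?thesis
      by (simp add: * field_simps)
  next
    case False
    then obtain k where "n = 2 * k"
      using evenE by blast
    then show ?thesis
      by (simp add: * field_simps)
  qed
qed

lemma total_stress_cycle:
  assumes "cycle_graph n G"
  shows "real (total_stress G) = (if odd n then real n * (real n - 1) * (real n - 3) / 8
           else (real n)\<^sup>2 * (real n - 2) / 8)"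
proof -
  obtain f where "cyclic_labelling G n f"
    using assms by (rule cycle_graph_obtains_labelling)
  then have "card (verts G) = n"
    by (rule cyclic_labelling.card_verts)
  then show ?thesis
    using stress_cycle[OF assms] by (simp add: total_stress_def power2_eq_square)
qed

section \<open>Windmill graphs\<close>

text \<open>Any two vertices are joined by a walk with at most two edges through the universal vertex; the
  definition of \<open>q\<close> omits an end that is itself the universal vertex.\<close>

lemma shortest_vpath_universal_vertex:
  assumes v: "v \<in> verts G"
    and universal: "\<And>x. x \<in> verts G \<Longrightarrow> x \<noteq> v \<Longrightarrow> (x, v) \<in> arcs_ends G \<and> (v, x) \<in> arcs_ends G"
    and p: "shortest_vpath G p"
  shows "length p \<le> 3"
proof -
  let ?x = "hd p" and ?y = "last p"
  note ends = shortest_vpath_ends_in_verts[OF p]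
  define q where "q = (if ?x = v then [] else [?x]) @ [v] @ (if ?y = v then [] else [?y])"
  have "vwalk q G" "hd q = ?x" "last q = ?y"
    using v ends universal[of ?x] universal[of ?y] by (auto simp: q_def vwalk_def)
  from shortest_vpath_le_vwalk[OF p this] have "length p \<le> length q" .
  also have "\<dots> \<le> 3"
    by (simp add: q_def)
  finally show ?thesis .
qed

text \<open>Let \<open>x, u, y\<close> be a path. If \<open>u\<close> is not the centre, then \<open>x\<close> and \<open>y\<close> lie in the only copy
  that contains \<open>u\<close>, hence are adjacent. If \<open>u\<close> is the centre, then \<open>x\<close> and \<open>y\<close> are arbitrary other
  vertices, and they are non-adjacent iff they lie in different copies.\<close>

lemma stress_windmill:
  assumes W: "windmill_graph n m v G" and n: "2 \<le> n" and m: "2 \<le> m"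
  shows "real (stress G v) = real m * (real m - 1) * (real n - 1)\<^sup>2 / 2"
    and "u \<in> verts G \<Longrightarrow> u \<noteq> v \<Longrightarrow> stress G u = 0"
proof -
  interpret graph G
    using W by (simp add: windmill_graph_def)
  obtain H :: "nat \<Rightarrow> ('a, 'b) pre_digraph" where
    copies: "\<forall>i<m. complete_digraph n (H i) \<and> v \<in> verts (H i)"
    and meet: "\<forall>i<m. \<forall>j<m. i \<noteq> j \<longrightarrow> verts (H i) \<inter> verts (H j) = {v}"
    and V: "verts G = (\<Union>i<m. verts (H i))"
    and arcs: "arcs_ends G = (\<Union>i<m. arcs_ends (H i))"
    using W unfolding windmill_graph_def by (elim conjE exE) (rule that)
  have H: "complete_digraph n (H i)" "v \<in> verts (H i)" if "i < m" for i
    using copies that by auto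
  have copy: "arcs_ends (H i) = {(x, y). x \<in> verts (H i) \<and> y \<in> verts (H i) \<and> x \<noteq> y}" if "i < m" for i
    using H(1)[OF that] by (simp add: complete_digraph_def)
  have adj: "(x, y) \<in> arcs_ends G \<longleftrightarrow> (\<exists>i<m. x \<in> verts (H i) \<and> y \<in> verts (H i) \<and> x \<noteq> y)" for x y
    by (auto simp: arcs copy)
  have same_copy: "i = j" if "i < m" "j < m" "x \<in> verts (H i)" "x \<in> verts (H j)" "x \<noteq> v" for i j x
    using meet that by blast
  have v: "v \<in> verts G"
    using H(2)[of 0] m V by auto
  have universal: "(x, v) \<in> arcs_ends G \<and> (v, x) \<in> arcs_ends G" if "x \<in> verts G" "x \<noteq> v" for x
    using that V H(2) by (auto simp: adj)
  note double = double_stress_short_geodesics[OF shortest_vpath_universal_vertex[OF v universal]]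
  define S where "S i = verts (H i) - {v}" for i
  define T where "T = (\<Union>i<m. S i)"
  have S: "finite (S i)" "card (S i) = n - 1" if "i < m" for i
  proof -
    show "finite (S i)"
      using that V finite_verts finite_subset[of "S i" "verts G"] by (auto simp: S_def)
    show "card (S i) = n - 1"
      using H[OF that] by (simp add: S_def complete_digraph_def)
  qed
  have disj: "S i \<inter> S j = {}" if "i < m" "j < m" "i \<noteq> j" for i j
    using meet that by (auto simp: S_def)
  define U where "U = (\<Union>i<m. S i \<times> S i)"
  have fin: "finite T"
    using S(1) by (simp add: T_def)
  have sub: "U \<subseteq> T \<times> T"
    by (auto simp: U_def T_def)
  have pairs: "{(x, y). (x, v) \<in> arcs_ends G \<and> (v, y) \<in> arcs_ends G \<and> x \<noteq> y \<and> (x, y) \<notin> arcs_ends G}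
      = T \<times> T - U"
  proof -
    have nbr: "(x, v) \<in> arcs_ends G \<longleftrightarrow> x \<in> T" "(v, x) \<in> arcs_ends G \<longleftrightarrow> x \<in> T" for x
      using H(2) by (auto simp: adj T_def S_def)
    have "x \<noteq> y \<and> (x, y) \<notin> arcs_ends G \<longleftrightarrow> (x, y) \<notin> U" if "x \<in> T" "y \<in> T" for x y
      using that by (auto simp: adj T_def S_def U_def)
    then show ?thesis
      unfolding nbr by blast
  qed
  have "card T = m * (n - 1)"
    unfolding T_def using S disj by (subst card_UN_disjoint) auto
  then have card_T: "card (T \<times> T) = (m * (n - 1))\<^sup>2"
    by (simp add: card_cartesian_product power2_eq_square)
  have "card U = (\<Sum>i<m. card (S i \<times> S i))"
    unfolding U_def using S disj by (intro card_UN_disjoint) fastforce+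
  then have card_U: "card U = m * (n - 1)\<^sup>2"
    using S by (simp add: card_cartesian_product power2_eq_square)
  have "2 * stress G v = card (T \<times> T) - card U"
    using double[of v] sub fin by (simp add: pairs card_Diff_subset finite_subset)
  moreover have "card U \<le> card (T \<times> T)"
    using sub fin by (intro card_mono) auto
  ultimately have "2 * stress G v + m * (n - 1)\<^sup>2 = (m * (n - 1))\<^sup>2"
    by (simp add: card_T card_U)
  then have "real (2 * stress G v + m * (n - 1)\<^sup>2) = real ((m * (n - 1))\<^sup>2)"
    by (simp only:)
  moreover have "real (n - 1) = real n - 1"
    using n by simp
  ultimately have "2 * real (stress G v) + real m * (real n - 1)\<^sup>2 = (real m * (real n - 1))\<^sup>2"
    by (simp only: of_nat_add of_nat_mult of_nat_power of_nat_numeral)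
  then show "real (stress G v) = real m * (real m - 1) * (real n - 1)\<^sup>2 / 2"
    by (simp add: power2_eq_square algebra_simps)
  assume u: "u \<in> verts G" "u \<noteq> v"
  have "(x, y) \<in> arcs_ends G" if xu: "(x, u) \<in> arcs_ends G" and uy: "(u, y) \<in> arcs_ends G" and "x \<noteq> y" for x y
  proof -
    obtain i where i: "i < m" "x \<in> verts (H i)" "u \<in> verts (H i)"
      using xu unfolding adj by blast
    obtain j where j: "j < m" "u \<in> verts (H j)" "y \<in> verts (H j)"
      using uy unfolding adj by blast
    have "i = j"
      using same_copy[OF i(1) j(1) i(3) j(2) u(2)] .
    then show ?thesis
      using i j \<open>x \<noteq> y\<close> unfolding adj by blast
  qed
  then have no_pairs: "{(x, y). (x, u) \<in> arcs_ends G \<and> (u, y) \<in> arcs_ends G \<and> x \<noteq> y \<and> (x, y) \<notin> arcs_ends G} = {}"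
    by blast
  then show "stress G u = 0"
    using double[of u] unfolding no_pairs by simp
qed

lemma total_stress_windmill:
  assumes W: "windmill_graph n m v G" and n: "2 \<le> n" and m: "2 \<le> m"
  shows "real (total_stress G) = real m * (real m - 1) * (real n - 1)\<^sup>2 / 2"
proof -
  interpret graph G
    using W by (simp add: windmill_graph_def)
  have "v \<in> verts G"
    using W m by (auto simp: windmill_graph_def intro!: exI[of _ 0])
  then have "total_stress G = stress G v + (\<Sum>u\<in>verts G - {v}. stress G u)"
    unfolding total_stress_def using finite_verts by (rule sum.remove[rotated])
  then show ?thesis
    using stress_windmill[OF W n m] by simp
qed

section \<open>Stress in the three families\<close>

theorem proposition3p1:
  shows "(\<forall>(G :: ('a, 'b) pre_digraph) (A :: 'a set) (B :: 'a set) (m :: nat) (n :: nat).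
            complete_bipartite_on A B G \<and> card A = m \<and> card B = n \<longrightarrow>
              (\<forall>v\<in>A. real (stress G v) = real n * (real n - 1) / 2) \<and>
              (\<forall>v\<in>B. real (stress G v) = real m * (real m - 1) / 2) \<and>
              real (total_stress G) = real m * real n / 2 * (real m + real n - 2))
       \<and> (\<forall>(G :: ('a, 'b) pre_digraph) (n :: nat).
            cycle_graph n G \<longrightarrow>
              (\<forall>v\<in>verts G. real (stress G v) =
                 (if odd n then (real n - 1) * (real n - 3) / 8
                  else real n * (real n - 2) / 8)) \<and>
              real (total_stress G) =
                 (if odd n then real n * (real n - 1) * (real n - 3) / 8
                  else (real n)\<^sup>2 * (real n - 2) / 8))
       \<and> (\<forall>(G :: ('a, 'b) pre_digraph) (v :: 'a) (n :: nat) (m :: nat).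
            n \<ge> 2 \<and> m \<ge> 2 \<and> windmill_graph n m v G \<longrightarrow>
              real (stress G v) = real m * (real m - 1) * (real n - 1)\<^sup>2 / 2 \<and>
              (\<forall>u\<in>verts G - {v}. stress G u = 0) \<and>
              real (total_stress G) = real m * (real m - 1) * (real n - 1)\<^sup>2 / 2)"
proof (intro conjI allI impI)
  fix G :: "('a, 'b) pre_digraph" and A B :: "'a set" and m n :: nat
  assume "complete_bipartite_on A B G \<and> card A = m \<and> card B = n"
  then have G: "complete_bipartite_on A B G" and card: "m = card A" "n = card B"
    by auto
  show "\<forall>v\<in>A. real (stress G v) = real n * (real n - 1) / 2"
    unfolding card by (intro ballI stress_complete_bipartite[OF G])
  show "\<forall>v\<in>B. real (stress G v) = real m * (real m - 1) / 2"
    unfolding card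
    by (intro ballI stress_complete_bipartite[OF complete_bipartite_on_commute[OF G]])
  show "real (total_stress G) = real m * real n / 2 * (real m + real n - 2)"
    unfolding card by (rule total_stress_complete_bipartite[OF G])
next
  fix G :: "('a, 'b) pre_digraph" and n :: nat
  assume G: "cycle_graph n G"
  show "\<forall>v\<in>verts G. real (stress G v) =
      (if odd n then (real n - 1) * (real n - 3) / 8 else real n * (real n - 2) / 8)"
    using stress_cycle[OF G] by blast
  show "real (total_stress G) = (if odd n then real n * (real n - 1) * (real n - 3) / 8
      else (real n)\<^sup>2 * (real n - 2) / 8)"
    by (rule total_stress_cycle[OF G])
next
  fix G :: "('a, 'b) pre_digraph" and v :: 'a and n m :: nat
  assume "2 \<le> n \<and> 2 \<le> m \<and> windmill_graph n m v G"
  then have G: "windmill_graph n m v G" "2 \<le> n" "2 \<le> m"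
    by auto
  show "real (stress G v) = real m * (real m - 1) * (real n - 1)\<^sup>2 / 2"
    by (rule stress_windmill(1)[OF G])
  show "\<forall>u\<in>verts G - {v}. stress G u = 0"
    using stress_windmill(2)[OF G] by blast
  show "real (total_stress G) = real m * (real m - 1) * (real n - 1)\<^sup>2 / 2"
    by (rule total_stress_windmill[OF G])
qed

end
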